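(* Let $0 \ne \eta \in \text{c}_{\text{o}}^*$. Then $r(\eta_a) \asymp \log$ if and only if $$\sup_{m}\,\frac{m^2(\eta_a)_{m^2}}{m(\eta_a)_m} < \infty .$$
   Context: $\text{c}_{\text{o}}^*$ is the set of nonnegative real sequences $\xi = (\xi_n)_{n\ge 1}$ that are nonincreasing and converge to $0$. For $\xi\in \text{c}_{\text{o}}^*$, $(\xi_a)_n := \frac1n\sum_{j=1}^n \xi_j$ and $\xi_{a^2} := (\xi_a)_a$. For $\xi$ with all $\xi_n>0$, the ratio of regularity is $r(\xi):=\xi_a/\xi$ (termwise), so $r(\eta_a) = \eta_{a^2}/\eta_a$. $r(\eta_a) \asymp \log$ means that $\alpha \log n \le r(\eta_a)_n \le \beta\log n$ for some $\alpha,\beta>0$ and all $n\ge 2$. The supremum is over all $m \in \mathbb N$, $m\ge 1$. *)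

theory Defs
  imports Complex_Main "HOL-Library.Extended_Real"
begin

(* Sequences are indexed by n >= 1 and encoded as functions nat => real;
   the value at index 0 is never inspected. *)

definition co_star :: "(nat \<Rightarrow> real) set" where
  "co_star = {\<xi>. (\<forall>n\<ge>1. 0 \<le> \<xi> n) \<and> antimono_on {1..} \<xi> \<and> \<xi> \<longlonglongrightarrow> 0}"

definition arith_mean :: "(nat \<Rightarrow> real) \<Rightarrow> nat \<Rightarrow> real" where
  "arith_mean \<xi> n = (1 / real n) * (\<Sum>j=1..n. \<xi> j)"

(* Meaningful for sequences with positive terms at all n >= 1. *)
definition ratio_of_regularity :: "(nat \<Rightarrow> real) \<Rightarrow> nat \<Rightarrow> real" where
  "ratio_of_regularity \<xi> n = arith_mean \<xi> n / \<xi> n"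

definition asymp_log :: "(nat \<Rightarrow> real) \<Rightarrow> bool" where
  "asymp_log f \<longleftrightarrow>
    (\<exists>\<alpha>>0. \<exists>\<beta>>0. \<forall>n\<ge>2. \<alpha> * ln (real n) \<le> f n \<and> f n \<le> \<beta> * ln (real n))"

end

theory Submission
  imports Defs "HOL-Library.Discrete_Functions"
begin

text \<open>
  Write \<open>S n = n (\<eta>\<^sub>a)\<^sub>n\<close> for the partial sums of \<open>\<eta>\<close> and \<open>T n = \<Sum>j\<le>n. S j / j\<close>,
  so that \<open>r (\<eta>\<^sub>a) n = T n / S n\<close> and the theorem compares the growth of \<open>T / S\<close> with
  the quotients \<open>S (m\<^sup>2) / S m\<close>.  The argument rests on \<open>S\<close> being positive
  and nondecreasing while \<open>S n / n\<close> is nonincreasing (because \<open>\<eta>\<close> is).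

  Monotonicity of \<open>S\<close> gives \<open>T n \<le> S n (1 + ln n)\<close>, so the upper half of \<open>T / S \<asymp> log\<close> is
  automatic and the question is when \<open>T n \<ge> \<alpha> ln n S n\<close>.

  If \<open>S (m\<^sup>2) \<le> K S m\<close>, then \<open>S\<close> changes at most by a constant factor between \<open>\<surd>n\<close> and \<open>n\<close>,
  and that range already carries half of the logarithmic mass, whence
  \<open>T n \<ge> ln n S n / (4 K)\<close> (\<open>ratio_lower_bound\<close>).

  Conversely, since \<open>S / x\<close> is the derivative of \<open>T\<close>, the bound \<open>T \<ge> \<alpha> ln x S\<close> is a
  differential inequality \<open>d (ln T) / d (ln (ln x)) \<le> 1 / \<alpha>\<close>: \<open>T\<close> grows at most like a
  power of \<open>ln\<close>.  Passing from \<open>m\<close> to \<open>m\<^sup>2\<close> doubles \<open>ln\<close>, so it multiplies \<open>T\<close>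
  by a bounded factor, and \<open>S\<close> inherits this because \<open>T\<close> and \<open>S ln\<close> are comparable
  (\<open>square_ratio_bound\<close>).  A discrete version of the differential inequality
  (\<open>T_over_ln_powr_decreasing\<close>) makes this precise.
\<close>

section \<open>Estimates for the logarithm at integers\<close>

lemma inverse_Suc_le_ln_diff:
  assumes "k \<ge> 1"
  shows "1 / real (Suc k) \<le> ln (real (Suc k)) - ln (real k)"
  using ln_diff_le[of "real k" "real (Suc k)"] assms by (simp add: field_simps)

lemma ln_diff_le_inverse:
  assumes "k \<ge> 1"
  shows "ln (real (Suc k)) - ln (real k) \<le> 1 / real k"
  using ln_diff_le[of "real (Suc k)" "real k"] assms by simp

text \<open>
  This compares the summand \<open>1 / (k ln k)\<close> with the increment of its antiderivative
  \<open>ln (ln x)\<close>.  The increment is at least the value at the right endpoint \<open>k + 1\<close>; moving to the left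
  endpoint costs a factor 2 from \<open>k + 1 \<le> 2 k\<close> and another from \<open>k + 1 \<le> k\<^sup>2\<close>.
\<close>

lemma inverse_mult_ln_le_ln_ln_diff:
  assumes k: "k \<ge> 2"
  shows "1 / (real k * ln (real k)) \<le> 4 * (ln (ln (real (Suc k))) - ln (ln (real k)))"
proof -
  define a where "a = ln (real k)"
  define b where "b = ln (real (Suc k))"
  have a: "a > 0" and ab: "a \<le> b" using k by (auto simp: a_def b_def)
  then have b: "b > 0" by linarith
  have "Suc k \<le> k ^ 2"
  proof -
    have "2 * k \<le> k * k" using k by (intro mult_right_mono) auto
    then show ?thesis unfolding power2_eq_square using k by linarith
  qed
  then have "real (Suc k) \<le> real k ^ 2"
    by (metis of_nat_le_iff of_nat_power)
  then have "b \<le> ln (real k ^ 2)"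
    unfolding b_def using k by (intro ln_mono) auto
  then have b2a: "b \<le> 2 * a"
    using k by (simp add: a_def ln_realpow)
  have "real (Suc k) * b \<le> (2 * real k) * (2 * a)"
    using k b b2a by (intro mult_mono) auto
  moreover have "0 < real k * a" and "0 < real (Suc k) * b"
    using a b k by auto
  ultimately have "1 / (real k * a) \<le> 4 * (1 / (real (Suc k) * b))"
    using frac_le[of 4 4 "real (Suc k) * b" "4 * (real k * a)"] by simp
  also have "1 / (real (Suc k) * b) \<le> (b - a) / b"
  proof -
    have "(1 / real (Suc k)) / b \<le> (b - a) / b"
      using inverse_Suc_le_ln_diff[of k] k b unfolding a_def b_def
      by (intro divide_right_mono) auto
    then show ?thesis by simp
  qed
  also have "(b - a) / b \<le> ln b - ln a"
    using ln_diff_le[of a b] a b by (simp add: field_simps)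
  finally show ?thesis by (simp add: a_def b_def)
qed

section \<open>Sequences growing at most linearly and their logarithmic means\<close>

text \<open>
  The growth condition says that \<open>S n / n\<close> is nonincreasing; the
  multiplied-out form also covers \<open>n = 0\<close>, where it reads \<open>0 \<le> S 0\<close>.
\<close>

locale sublinear_seq =
  fixes S :: "nat \<Rightarrow> real"
  assumes mono_S: "mono S"
    and S_1_pos: "S 1 > 0"
    and S_Suc_le: "real n * S (Suc n) \<le> real (Suc n) * S n"
begin

definition T :: "nat \<Rightarrow> real" where
  "T n = (\<Sum>j=1..n. S j / real j)"

lemma S_mono: "i \<le> j \<Longrightarrow> S i \<le> S j"
  using mono_S by (rule monoD)

lemma S_pos: "n \<ge> 1 \<Longrightarrow> S n > 0"
  using S_mono[of 1 n] S_1_pos by linarith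

lemma T_Suc: "T (Suc n) = T n + S (Suc n) / real (Suc n)"
  by (simp add: T_def)

lemma S_div_le_T:
  assumes "n \<ge> 1"
  shows "S n / real n \<le> T n"
  unfolding T_def using assms S_pos
  by (intro member_le_sum[where f = "\<lambda>j. S j / real j"]) (auto intro!: divide_nonneg_nonneg less_imp_le)

lemma T_pos: "n \<ge> 1 \<Longrightarrow> T n > 0"
  using S_div_le_T[of n] S_pos[of n] divide_pos_pos[of "S n" "real n"] by linarith

lemma S_Suc_le_double:
  assumes "m \<ge> 1"
  shows "S (Suc m) \<le> 2 * S m"
proof -
  have "real m * S (Suc m) \<le> real (Suc m) * S m" by (rule S_Suc_le)
  also have "\<dots> \<le> real m * (2 * S m)"
    using assms S_pos[of m] mult_right_mono[of "real (Suc m)" "real m * 2" "S m"]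
    by (simp add: mult.assoc)
  finally show ?thesis using assms by simp
qed

lemma T_le_S_ln:
  assumes "n \<ge> 1"
  shows "T n \<le> S n * (1 + ln (real n))"
  using assms
proof (induction n rule: dec_induct)
  case base
  then show ?case by (simp add: T_def)
next
  case (step n)
  have "T (Suc n) \<le> S n * (1 + ln (real n)) + S (Suc n) / real (Suc n)"
    using step by (simp add: T_Suc)
  also have "\<dots> \<le> S (Suc n) * (1 + ln (real n)) + S (Suc n) / real (Suc n)"
    using step S_mono[of n "Suc n"] by (intro add_right_mono mult_right_mono) auto
  also have "\<dots> = S (Suc n) * (1 + ln (real n) + 1 / real (Suc n))"
    by (simp add: algebra_simps)
  also have "\<dots> \<le> S (Suc n) * (1 + ln (real (Suc n)))"
    using inverse_Suc_le_ln_diff[of n] step S_pos[of "Suc n"]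
    by (intro mult_left_mono) auto
  finally show ?case .
qed

text \<open>For the absolute constant: \<open>1 \<le> ln n / ln 2\<close> absorbs the summand 1 as soon as \<open>n \<ge> 2\<close>.\<close>

lemma ratio_upper_bound:
  assumes "n \<ge> 2"
  shows "T n / S n \<le> (1 + 1 / ln 2) * ln (real n)"
proof -
  have "1 + ln (real n) \<le> (1 + 1 / ln 2) * ln (real n)"
    using assms by (simp add: field_simps)
  then show ?thesis
    using T_le_S_ln[of n] S_pos[of n] assms
    by (simp add: pos_divide_le_eq mult.commute) (smt (verit) mult_left_mono mult.commute)
qed

text \<open>The terms from \<open>m\<close> to \<open>n\<close> alone give this, since there \<open>S\<close> is at least \<open>S m\<close>.\<close>

lemma S_ln_le_T:
  assumes "1 \<le> m" "m \<le> n"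
  shows "S m * (ln (real (Suc n)) - ln (real m)) \<le> T n"
  using assms(2)
proof (induction n rule: dec_induct)
  case base
  have "S m * (ln (real (Suc m)) - ln (real m)) \<le> S m * (1 / real m)"
    using ln_diff_le_inverse[OF assms(1)] S_pos[OF assms(1)] by (intro mult_left_mono) auto
  also have "\<dots> \<le> T m" using S_div_le_T[OF assms(1)] by simp
  finally show ?case .
next
  case (step n)
  have "S m * (ln (real (Suc (Suc n))) - ln (real (Suc n))) \<le> S (Suc n) * (1 / real (Suc n))"
    using ln_diff_le_inverse[of "Suc n"] S_mono[of m "Suc n"] S_pos[of "Suc n"] step
    by (intro mult_mono) auto
  with step.IH show ?case
    by (simp add: T_Suc algebra_simps)
qed

section \<open>From bounded square ratios to a logarithmic lower bound\<close>

text \<open>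
  With \<open>m = \<lfloor>\<surd>n\<rfloor>\<close> the range from \<open>m\<close> to \<open>n\<close> has logarithmic length at least \<open>ln n / 2\<close>.  The
  hypothesis must be used at \<open>m + 1\<close> so that the square reaches \<open>n\<close>; going back from \<open>m + 1\<close> to \<open>m\<close>
  costs the second factor 2.
\<close>

lemma ratio_lower_bound:
  assumes K: "\<And>m. m \<ge> 1 \<Longrightarrow> S (m\<^sup>2) \<le> K * S m" and Kpos: "K > 0" and n: "n \<ge> 1"
  shows "1 / (4 * K) * ln (real n) \<le> T n / S n"
proof -
  define m where "m = floor_sqrt n"
  have mn: "m\<^sup>2 \<le> n" and nm: "n \<le> (Suc m)\<^sup>2"
    using Suc_floor_sqrt_power2_gt[of n] by (simp_all add: m_def less_imp_le)
  have m1: "m \<ge> 1" using n by (simp add: m_def Suc_le_eq)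
  have m_le: "m \<le> n" unfolding m_def by (rule floor_sqrt_le)
  have "real m ^ 2 \<le> real n" using mn by (metis of_nat_le_iff of_nat_power)
  then have "ln (real m ^ 2) \<le> ln (real n)" using m1 by (intro ln_mono) auto
  then have lnm: "2 * ln (real m) \<le> ln (real n)" using m1 by (simp add: ln_realpow)
  have "S n \<le> S ((Suc m)\<^sup>2)" using nm by (rule S_mono)
  also have "\<dots> \<le> K * S (Suc m)" by (rule K) simp
  also have "\<dots> \<le> K * (2 * S m)" using S_Suc_le_double[OF m1] Kpos by simp
  finally have SnSm: "S n \<le> 2 * K * S m" by simp
  have "S n * ln (real n) \<le> (2 * K * S m) * ln (real n)"
    using SnSm n by (intro mult_right_mono) auto
  also have "\<dots> = 4 * K * (S m * (ln (real n) / 2))" by simp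
  also have "\<dots> \<le> 4 * K * (S m * (ln (real (Suc n)) - ln (real m)))"
  proof -
    have "ln (real n) \<le> ln (real (Suc n))" using n by (intro ln_mono) auto
    then have "ln (real n) / 2 \<le> ln (real (Suc n)) - ln (real m)" using lnm by simp
    then show ?thesis using Kpos S_pos[OF m1] by (intro mult_left_mono) auto
  qed
  also have "\<dots> \<le> 4 * K * T n"
    using S_ln_le_T[OF m1 m_le] Kpos by (intro mult_left_mono) auto
  finally show ?thesis using S_pos[OF n] Kpos by (simp add: field_simps)
qed

section \<open>From a logarithmic lower bound to bounded square ratios\<close>

text \<open>
  The discrete form of \<open>d (ln T) / d (ln (ln x)) \<le> 1 / \<alpha>\<close>.  Because \<open>S n / n\<close> is
  nonincreasing, the increment \<open>S (k + 1) / (k + 1)\<close> of \<open>T\<close> is at most \<open>S k / k\<close>, which the hypothesis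
  bounds by \<open>T k / (\<alpha> k ln k)\<close>.  Having \<open>T k\<close> here rather than \<open>T (k + 1)\<close> makes the step work for
  every \<open>k \<ge> 2\<close>, however large \<open>1 / (\<alpha> k ln k)\<close> is.
\<close>

lemma T_over_ln_powr_decreasing:
  assumes lower: "\<And>n. n \<ge> 2 \<Longrightarrow> \<alpha> * ln (real n) * S n \<le> T n" and \<alpha>: "\<alpha> > 0"
    and m: "2 \<le> m" and mn: "m \<le> n"
  shows "T n / ln (real n) powr (4 / \<alpha>) \<le> T m / ln (real m) powr (4 / \<alpha>)"
  using mn
proof (induction n rule: dec_induct)
  case base
  then show ?case by simp
next
  case (step k)
  define a where "a = ln (real k)"
  define b where "b = ln (real (Suc k))"
  have k: "k \<ge> 2" using m step by simp
  have a: "a > 0" and ab: "a \<le> b" using k by (auto simp: a_def b_def)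
  then have b: "b > 0" by linarith
  have "S (Suc k) / real (Suc k) \<le> S k / real k"
    using S_Suc_le[of k] k by (simp add: field_simps)
  also have "\<dots> \<le> T k * (1 / \<alpha> * (1 / (real k * a)))"
    using lower[OF k] k a \<alpha> by (simp add: a_def field_simps)
  finally have "T (Suc k) \<le> T k * (1 + 1 / \<alpha> * (1 / (real k * a)))"
    by (simp add: T_Suc algebra_simps)
  also have "\<dots> \<le> T k * (1 + 1 / \<alpha> * (4 * (ln b - ln a)))"
    using inverse_mult_ln_le_ln_ln_diff[OF k] T_pos[of k] k \<alpha> unfolding a_def b_def
    by (intro mult_left_mono add_left_mono) auto
  also have "\<dots> \<le> T k * exp (4 / \<alpha> * (ln b - ln a))"
    using exp_ge_add_one_self[of "4 / \<alpha> * (ln b - ln a)"] T_pos[of k] k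
    by (intro mult_left_mono) auto
  also have "\<dots> = T k * (b powr (4 / \<alpha>) / a powr (4 / \<alpha>))"
    using a b by (simp add: powr_def exp_diff right_diff_distrib)
  finally have "T (Suc k) / b powr (4 / \<alpha>) \<le> T k / a powr (4 / \<alpha>)"
    using a b by (simp add: field_simps)
  with step.IH show ?case by (simp add: a_def b_def)
qed

lemma square_ratio_bound:
  assumes lower: "\<And>n. n \<ge> 2 \<Longrightarrow> \<alpha> * ln (real n) * S n \<le> T n" and \<alpha>: "\<alpha> > 0"
    and m: "m \<ge> 2"
  shows "S (m\<^sup>2) / S m \<le> 2 powr (4 / \<alpha>) * (1 + 1 / ln 2) / (2 * \<alpha>)"
proof -
  define c where "c = 2 powr (4 / \<alpha>)"
  define l where "l = ln (real m)"
  have l: "l > 0" using m by (simp add: l_def)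
  have c: "c > 0" by (simp add: c_def)
  have mm: "m \<le> m\<^sup>2" using m by (simp add: power2_eq_square)
  have l2: "ln (real (m\<^sup>2)) = 2 * l" using m by (simp add: l_def ln_realpow)
  have "T (m\<^sup>2) / (2 * l) powr (4 / \<alpha>) \<le> T m / l powr (4 / \<alpha>)"
    using T_over_ln_powr_decreasing[OF lower \<alpha> m mm] unfolding l2 by (simp add: l_def)
  moreover have "(2 * l) powr (4 / \<alpha>) = c * l powr (4 / \<alpha>)"
    using l by (simp add: powr_mult c_def)
  ultimately have T2: "T (m\<^sup>2) \<le> c * T m"
    using l c by (simp add: field_simps)
  have "2 * \<alpha> * l * S (m\<^sup>2) = \<alpha> * ln (real (m\<^sup>2)) * S (m\<^sup>2)" unfolding l2 by simp
  also have "\<dots> \<le> T (m\<^sup>2)" using lower[of "m\<^sup>2"] m mm by linarith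
  also note T2
  also have "c * T m \<le> c * ((1 + 1 / ln 2) * l * S m)"
    using ratio_upper_bound[OF m] S_pos[of m] m c
    by (intro mult_left_mono) (auto simp: l_def pos_divide_le_eq)
  finally have "l * (2 * \<alpha> * S (m\<^sup>2)) \<le> l * (c * (1 + 1 / ln 2) * S m)"
    by (simp add: mult_ac)
  then have "2 * \<alpha> * S (m\<^sup>2) \<le> c * (1 + 1 / ln 2) * S m"
    using l by (simp only: mult_le_cancel_left_pos)
  then show ?thesis
    using S_pos[of m] m \<alpha> unfolding c_def[symmetric]
    by (simp add: pos_divide_le_eq pos_le_divide_eq mult_ac)
qed

theorem asymp_log_iff_square_ratio_bounded:
  "asymp_log (\<lambda>n. T n / S n) \<longleftrightarrow> (\<exists>K. \<forall>m\<ge>1. S (m\<^sup>2) / S m \<le> K)"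
proof
  assume "asymp_log (\<lambda>n. T n / S n)"
  then obtain \<alpha> where \<alpha>: "\<alpha> > 0" and ratio: "\<And>n. n \<ge> 2 \<Longrightarrow> \<alpha> * ln (real n) \<le> T n / S n"
    unfolding asymp_log_def by blast
  then have lower: "\<alpha> * ln (real n) * S n \<le> T n" if "n \<ge> 2" for n
    using that ratio[OF that] S_pos[of n] by (simp add: pos_le_divide_eq)
  let ?K = "2 powr (4 / \<alpha>) * (1 + 1 / ln 2) / (2 * \<alpha>)"
  have "S (m\<^sup>2) / S m \<le> max 1 ?K" if "m \<ge> 1" for m
  proof (cases "m = 1")
    case True
    then show ?thesis using S_1_pos by simp
  next
    case False
    then show ?thesis using square_ratio_bound[OF lower \<alpha>, of m] that by simp
  qed
  then show "\<exists>K. \<forall>m\<ge>1. S (m\<^sup>2) / S m \<le> K" by blast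
next
  assume "\<exists>K. \<forall>m\<ge>1. S (m\<^sup>2) / S m \<le> K"
  then obtain K where K: "\<And>m. m \<ge> 1 \<Longrightarrow> S (m\<^sup>2) / S m \<le> K" by blast
  have Kpos: "K > 0" using K[of 1] S_1_pos by simp
  have "S (m\<^sup>2) \<le> K * S m" if "m \<ge> 1" for m
    using K[OF that] S_pos[OF that] by (simp add: pos_divide_le_eq)
  from ratio_lower_bound[OF this Kpos]
  have "1 / (4 * K) * ln (real n) \<le> T n / S n" if "n \<ge> 2" for n
    using that by simp
  moreover have "1 / (4 * K) > 0" "1 + 1 / ln 2 > (0::real)"
    using Kpos by (auto intro: add_pos_pos)
  ultimately show "asymp_log (\<lambda>n. T n / S n)"
    unfolding asymp_log_def using ratio_upper_bound by blast
qed

end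

section \<open>Partial sums of nonincreasing null sequences\<close>

lemma sublinear_seq_partial_sums:
  assumes "\<eta> \<in> co_star" and "\<exists>n\<ge>1. \<eta> n \<noteq> 0"
  shows "sublinear_seq (\<lambda>n. \<Sum>j=1..n. \<eta> j)"
proof
  have nonneg: "0 \<le> \<eta> n" if "n \<ge> 1" for n using assms(1) that by (simp add: co_star_def)
  have decr: "\<eta> j \<le> \<eta> i" if "1 \<le> i" "i \<le> j" for i j
    using assms(1) that by (auto simp: co_star_def monotone_on_def)
  show "mono (\<lambda>n. \<Sum>j=1..n. \<eta> j)"
    by (auto intro!: monoI sum_mono2 nonneg)
  show "(\<Sum>j=1..1. \<eta> j) > 0"
  proof -
    obtain n where n: "n \<ge> 1" "\<eta> n \<noteq> 0" using assms(2) by blast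
    then have "\<eta> n > 0" using nonneg[of n] by simp
    then show ?thesis using decr[of 1 n] n by simp
  qed
  show "real n * (\<Sum>j=1..Suc n. \<eta> j) \<le> real (Suc n) * (\<Sum>j=1..n. \<eta> j)" for n
  proof -
    have "real n * \<eta> (Suc n) = (\<Sum>j=1..n. \<eta> (Suc n))" by simp
    also have "\<dots> \<le> (\<Sum>j=1..n. \<eta> j)" by (intro sum_mono decr) auto
    finally show ?thesis by (simp add: algebra_simps)
  qed
qed

lemma SUP_ereal_less_infinity_iff:
  assumes "A \<noteq> {}"
  shows "(SUP x\<in>A. ereal (f x)) < \<infinity> \<longleftrightarrow> (\<exists>K. \<forall>x\<in>A. f x \<le> K)"
proof
  assume fin: "(SUP x\<in>A. ereal (f x)) < \<infinity>"
  obtain a where "a \<in> A" using assms by blast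
  then have "ereal (f a) \<le> (SUP x\<in>A. ereal (f x))" by (rule SUP_upper)
  with fin obtain K where K: "(SUP x\<in>A. ereal (f x)) = ereal K"
    by (cases "SUP x\<in>A. ereal (f x)") auto
  have "f x \<le> K" if "x \<in> A" for x
    using SUP_upper[OF that, of "\<lambda>x. ereal (f x)"] unfolding K by simp
  then show "\<exists>K. \<forall>x\<in>A. f x \<le> K" by blast
next
  assume "\<exists>K. \<forall>x\<in>A. f x \<le> K"
  then obtain K where "\<And>x. x \<in> A \<Longrightarrow> f x \<le> K" by blast
  then have "(SUP x\<in>A. ereal (f x)) \<le> ereal K" by (intro SUP_least) simp
  then show "(SUP x\<in>A. ereal (f x)) < \<infinity>" by (rule le_less_trans) simp
qed

theorem proposition3p11:
  fixes \<eta> :: "nat \<Rightarrow> real"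
  assumes "\<eta> \<in> co_star"
    and "\<exists>n\<ge>1. \<eta> n \<noteq> 0"
  shows "asymp_log (ratio_of_regularity (arith_mean \<eta>)) \<longleftrightarrow>
    (SUP m\<in>{1::nat..}.
       ereal ((real (m\<^sup>2) * arith_mean \<eta> (m\<^sup>2)) / (real m * arith_mean \<eta> m))) < \<infinity>"
proof -
  define S where "S = (\<lambda>n. \<Sum>j=1..n. \<eta> j)"
  interpret sublinear_seq S
    unfolding S_def using assms by (rule sublinear_seq_partial_sums)
  have mean: "arith_mean \<eta> = (\<lambda>n. S n / real n)"
    by (simp add: fun_eq_iff arith_mean_def S_def)
  have ratio: "ratio_of_regularity (arith_mean \<eta>) n = T n / S n" for n
  proof (cases "n = 0")
    case True
    then show ?thesis by (simp add: ratio_of_regularity_def mean T_def)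
  next
    case False
    then show ?thesis by (simp add: ratio_of_regularity_def mean arith_mean_def T_def)
  qed
  have square_ratio:
    "(real (m\<^sup>2) * arith_mean \<eta> (m\<^sup>2)) / (real m * arith_mean \<eta> m) = S (m\<^sup>2) / S m"
    if "m \<ge> 1" for m
    using that by (simp add: mean)
  have "asymp_log (ratio_of_regularity (arith_mean \<eta>)) \<longleftrightarrow> (\<exists>K. \<forall>m\<ge>1. S (m\<^sup>2) / S m \<le> K)"
    using asymp_log_iff_square_ratio_bounded by (simp add: ratio[abs_def])
  also have "\<dots> \<longleftrightarrow> (\<exists>K. \<forall>m\<in>{1::nat..}.
      (real (m\<^sup>2) * arith_mean \<eta> (m\<^sup>2)) / (real m * arith_mean \<eta> m) \<le> K)"
    by (simp add: Ball_def square_ratio del: of_nat_power cong: imp_cong)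
  also have "\<dots> \<longleftrightarrow> (SUP m\<in>{1::nat..}.
      ereal ((real (m\<^sup>2) * arith_mean \<eta> (m\<^sup>2)) / (real m * arith_mean \<eta> m))) < \<infinity>"
    by (rule SUP_ereal_less_infinity_iff[symmetric]) simp
  finally show ?thesis .
qed

end
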